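(* Let $\mathcal{C}\subset\mathbb{P}^2$ be a projective plane curve over $\mathbb{C}$ that is invariant under an automorphism $\phi\in\operatorname{Aut}(\mathbb{P}^2)$, and let $L\subset\mathbb{P}^2$ be a line fixed pointwise by $\phi$. Suppose $P,Q\in\mathcal{C}$ are smooth points of $\mathcal{C}$ in the same orbit under $\phi$ (i.e. $Q=\phi^k(P)$ for some $k\in\mathbb{Z}$), and let $\Gamma_P$ and $\Gamma_Q$ be the osculating curves of degree $n$ to $\mathcal{C}$ at $P$ and $Q$, respectively. Then $$\Gamma_P\cap L=\Gamma_Q\cap L.$$
   Context: For a plane curve $\mathcal{C}$ and a smooth point $p\in\mathcal{C}$, the osculating curve of degree $n$ to $\mathcal{C}$ at $p$ is the unique curve $\Sigma_p$ of degree $n$ with intersection multiplicity $(\mathcal{C}.\Sigma_p)_p\geq\frac12 n(n+3)$; existence and uniqueness of this curve at the points considered is presupposed in speaking of the osculating curve. *)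

theory Defs
  imports
    "HOL-Analysis.Analysis"
    "HOL-Library.Poly_Mapping"
    "HOL-Library.Extended_Nat"
    "HOL-Computational_Algebra.Fraction_Field"
begin

section \<open>Polynomials in three variables\<close>

text \<open>The variables are indexed by the three-element type \<open>3\<close>; a polynomial is a finitely
  supported map from exponent vectors to coefficients.\<close>

type_synonym poly3 = "(3 \<Rightarrow>\<^sub>0 nat) \<Rightarrow>\<^sub>0 complex"

definition const3 :: "complex \<Rightarrow> poly3" where
  "const3 c = Poly_Mapping.single 0 c"

definition insertion :: "(complex \<Rightarrow> 'a::comm_semiring_1) \<Rightarrow> (3 \<Rightarrow> 'a) \<Rightarrow> poly3 \<Rightarrow> 'a" where
  "insertion h x F =
     (\<Sum>m\<in>Poly_Mapping.keys F. h (Poly_Mapping.lookup F m) * (\<Prod>i\<in>UNIV. x i ^ Poly_Mapping.lookup m i))"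

definition peval :: "poly3 \<Rightarrow> complex ^ 3 \<Rightarrow> complex" where
  "peval F v = insertion (\<lambda>c. c) (\<lambda>i. v $ i) F"

definition psubst :: "(3 \<Rightarrow> poly3) \<Rightarrow> poly3 \<Rightarrow> poly3" where
  "psubst G F = insertion const3 G F"

definition partial_deriv :: "3 \<Rightarrow> poly3 \<Rightarrow> poly3" where
  "partial_deriv i F =
     (\<Sum>m\<in>Poly_Mapping.keys F. Poly_Mapping.single (m - Poly_Mapping.single i 1)
        (of_nat (Poly_Mapping.lookup m i) * Poly_Mapping.lookup F m))"

text \<open>The zero polynomial is homogeneous of every degree.\<close>

definition homogeneous :: "nat \<Rightarrow> poly3 \<Rightarrow> bool" where
  "homogeneous d F \<longleftrightarrow> (\<forall>m\<in>Poly_Mapping.keys F. (\<Sum>i\<in>UNIV. Poly_Mapping.lookup m i) = d)"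


section \<open>The complex projective plane\<close>

definition proj_rel :: "complex ^ 3 \<Rightarrow> complex ^ 3 \<Rightarrow> bool" where
  "proj_rel v w \<longleftrightarrow> v \<noteq> 0 \<and> (\<exists>c. c \<noteq> 0 \<and> w = c *s v)"

lemma part_equivp_proj_rel: "part_equivp proj_rel"
proof (rule part_equivpI)
  show "\<exists>v. proj_rel v v"
    by (rule exI[of _ "axis 1 1"]) (auto simp: proj_rel_def axis_eq_0_iff intro!: exI[of _ 1])
  show "symp proj_rel"
  proof (rule sympI)
    fix v w assume "proj_rel v w"
    then obtain c where c: "v \<noteq> 0" "c \<noteq> 0" "w = c *s v" by (auto simp: proj_rel_def)
    then have "v = inverse c *s w" by (simp add: vector_smult_assoc)
    moreover have "w \<noteq> 0" using c by (simp add: vector_mul_eq_0)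
    ultimately show "proj_rel w v"
      using c by (auto simp: proj_rel_def intro!: exI[of _ "inverse c"])
  qed
  show "transp proj_rel"
  proof (rule transpI)
    fix u v w assume "proj_rel u v" "proj_rel v w"
    then obtain c d where "u \<noteq> 0" "c \<noteq> 0" "v = c *s u" "d \<noteq> 0" "w = d *s v"
      by (auto simp: proj_rel_def)
    then show "proj_rel u w"
      by (auto simp: proj_rel_def vector_smult_assoc intro!: exI[of _ "d * c"])
  qed
qed

text \<open>\<open>proj_pt v\<close> is the point with homogeneous coordinates \<open>v \<noteq> 0\<close>, and \<open>coords p\<close> is a chosen
  vector of homogeneous coordinates of \<open>p\<close>.  The vanishing of a form at \<open>coords p\<close>
  does not depend on the choice.\<close>

quotient_type proj_plane = "complex ^ 3" / partial: proj_rel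
  morphisms coords proj_pt
  by (rule part_equivp_proj_rel)


section \<open>Plane curves\<close>

definition curve_rel :: "poly3 \<Rightarrow> poly3 \<Rightarrow> bool" where
  "curve_rel F G \<longleftrightarrow> F \<noteq> 0 \<and> (\<exists>d>0. homogeneous d F) \<and> (\<exists>c. c \<noteq> 0 \<and> G = const3 c * F)"

lemma const3_mult: "const3 a * const3 b = const3 (a * b)"
  by (simp add: const3_def mult_single)

lemma const3_1: "const3 1 = 1"
  by (simp add: const3_def)

lemma homogeneous_const3_mult:
  assumes "homogeneous d F"
  shows "homogeneous d (const3 c * F)"
proof -
  have "Poly_Mapping.keys (const3 c * F) \<subseteq> Poly_Mapping.keys F"
    using keys_mult[of "const3 c" F] by (auto simp: const3_def split: if_splits)
  then show ?thesis using assms by (auto simp: homogeneous_def)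
qed

lemma const3_eq_0_iff: "const3 c = 0 \<longleftrightarrow> c = 0"
  by (metis const3_def lookup_single_eq lookup_zero single_zero)

lemma part_equivp_curve_rel: "part_equivp curve_rel"
proof (rule part_equivpI)
  let ?X = "Poly_Mapping.single (Poly_Mapping.single 1 1) 1 :: poly3"
  have "?X \<noteq> 0"
    by (metis lookup_single_eq lookup_zero zero_neq_one)
  moreover have "homogeneous 1 ?X"
    by (simp add: homogeneous_def lookup_single when_def)
  ultimately have "curve_rel ?X ?X"
    by (auto simp: curve_rel_def const3_1 intro!: exI[of _ 1])
  then show "\<exists>F. curve_rel F F" ..
  show "symp curve_rel"
  proof (rule sympI)
    fix F G assume "curve_rel F G"
    then obtain c d where c: "F \<noteq> 0" "d > 0" "homogeneous d F" "c \<noteq> 0" "G = const3 c * F"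
      by (auto simp: curve_rel_def)
    then have "F = const3 (inverse c) * G"
      by (simp add: mult.assoc[symmetric] const3_mult const3_1)
    moreover have "G \<noteq> 0" "homogeneous d G" "inverse c \<noteq> 0"
      using c by (simp_all add: const3_eq_0_iff homogeneous_const3_mult)
    ultimately show "curve_rel G F" using c(2) unfolding curve_rel_def by blast
  qed
  show "transp curve_rel"
  proof (rule transpI)
    fix F G H assume "curve_rel F G" "curve_rel G H"
    then obtain c e where "F \<noteq> 0" "\<exists>d>0. homogeneous d F" "c \<noteq> 0" "G = const3 c * F"
      "e \<noteq> 0" "H = const3 e * G"
      by (auto simp: curve_rel_def)
    then show "curve_rel F H"
      by (auto simp: curve_rel_def mult.assoc[symmetric] const3_mult intro!: exI[of _ "e * c"])
  qed
qed

text \<open>A plane curve is a nonzero form of positive degree up to a nonzero constant, so that curves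
  may be reducible and may have multiple components (as osculating curves can).\<close>

quotient_type plane_curve = poly3 / partial: curve_rel
  morphisms curve_eqn curve_of
  by (rule part_equivp_curve_rel)

definition curve_degree :: "plane_curve \<Rightarrow> nat" where
  "curve_degree C = (THE d. homogeneous d (curve_eqn C))"

definition curve_points :: "plane_curve \<Rightarrow> proj_plane set" where
  "curve_points C = {p. peval (curve_eqn C) (coords p) = 0}"

definition smooth_point :: "plane_curve \<Rightarrow> proj_plane \<Rightarrow> bool" where
  "smooth_point C p \<longleftrightarrow>
     p \<in> curve_points C \<and> (\<exists>i. peval (partial_deriv i (curve_eqn C)) (coords p) \<noteq> 0)"


section \<open>Automorphisms of the plane\<close>

text \<open>A morphism from the plane to itself is given by three forms of the same degree without a
  common zero.\<close>

definition represents :: "(3 \<Rightarrow> poly3) \<Rightarrow> (proj_plane \<Rightarrow> proj_plane) \<Rightarrow> bool" where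
  "represents G f \<longleftrightarrow>
     (\<exists>d. \<forall>i. homogeneous d (G i)) \<and>
     (\<forall>v. v \<noteq> 0 \<longrightarrow> (\<exists>i. peval (G i) v \<noteq> 0) \<and> f (proj_pt v) = proj_pt (\<chi> i. peval (G i) v))"

definition plane_morphism :: "(proj_plane \<Rightarrow> proj_plane) \<Rightarrow> bool" where
  "plane_morphism f \<longleftrightarrow> (\<exists>G. represents G f)"

definition plane_automorphism :: "(proj_plane \<Rightarrow> proj_plane) \<Rightarrow> bool" where
  "plane_automorphism f \<longleftrightarrow> bij f \<and> plane_morphism f \<and> plane_morphism (inv f)"

definition int_iterate :: "('a \<Rightarrow> 'a) \<Rightarrow> int \<Rightarrow> 'a \<Rightarrow> 'a" where
  "int_iterate f k = (if k \<ge> 0 then f ^^ nat k else inv f ^^ nat (- k))"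

text \<open>The image of a curve \<open>F = 0\<close> under an automorphism \<open>f\<close> is the curve \<open>F \<circ> f\<^sup>-\<^sup>1 = 0\<close>.
  The forms representing a morphism are unique up to a common nonzero constant, hence the curve
  does not depend on the choice.\<close>

definition curve_image :: "(proj_plane \<Rightarrow> proj_plane) \<Rightarrow> plane_curve \<Rightarrow> plane_curve" where
  "curve_image f C = curve_of (psubst (SOME G. represents G (inv f)) (curve_eqn C))"

definition invariant_curve :: "(proj_plane \<Rightarrow> proj_plane) \<Rightarrow> plane_curve \<Rightarrow> bool" where
  "invariant_curve f C \<longleftrightarrow> curve_image f C = C"


section \<open>Intersection multiplicity\<close>

definition local_ring :: "proj_plane \<Rightarrow> poly3 fract set" where
  "local_ring p =
     {Fract A S | A S d. homogeneous d A \<and> homogeneous d S \<and> peval S (coords p) \<noteq> 0}"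

text \<open>The ideal of \<open>local_ring p\<close> generated by a local equation of the curve at \<open>p\<close>.\<close>

definition local_ideal :: "plane_curve \<Rightarrow> proj_plane \<Rightarrow> poly3 fract set" where
  "local_ideal C p =
     {Fract (H * curve_eqn C) S | H S d.
        homogeneous d (H * curve_eqn C) \<and> homogeneous d S \<and> peval S (coords p) \<noteq> 0}"

definition independent_modulo :: "poly3 fract set \<Rightarrow> poly3 fract set \<Rightarrow> bool" where
  "independent_modulo I B \<longleftrightarrow>
     (\<forall>c. (\<Sum>b\<in>B. Fract (const3 (c b)) 1 * b) \<in> I \<longrightarrow> (\<forall>b\<in>B. c b = 0))"

text \<open>The complex dimension of \<open>R / I\<close>, possibly \<open>\<infinity>\<close>.\<close>

definition quotient_dim :: "poly3 fract set \<Rightarrow> poly3 fract set \<Rightarrow> enat" where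
  "quotient_dim R I = (SUP B\<in>{B. finite B \<and> B \<subseteq> R \<and> independent_modulo I B}. enat (card B))"

definition intersection_mult :: "plane_curve \<Rightarrow> plane_curve \<Rightarrow> proj_plane \<Rightarrow> enat" where
  "intersection_mult C D p =
     quotient_dim (local_ring p) {a + b | a b. a \<in> local_ideal C p \<and> b \<in> local_ideal D p}"


section \<open>Osculating curves\<close>

text \<open>The product \<open>n (n + 3)\<close> is always even, so the division is exact.\<close>

definition osculates :: "nat \<Rightarrow> plane_curve \<Rightarrow> proj_plane \<Rightarrow> plane_curve \<Rightarrow> bool" where
  "osculates n C p D \<longleftrightarrow>
     curve_degree D = n \<and> intersection_mult C D p \<ge> enat (n * (n + 3) div 2)"

definition is_osculating_curve :: "nat \<Rightarrow> plane_curve \<Rightarrow> proj_plane \<Rightarrow> plane_curve \<Rightarrow> bool" where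
  "is_osculating_curve n C p D \<longleftrightarrow> osculates n C p D \<and> (\<forall>D'. osculates n C p D' \<longrightarrow> D' = D)"

end

theory Submission
  imports Defs "HOL-Computational_Algebra.Fundamental_Theorem_Algebra"
begin

text \<open>An automorphism of the plane is induced by an invertible matrix, and so is its power \<open>\<psi>\<close> that
  takes \<open>P\<close> to \<open>Q\<close>. The linear change of coordinates maps the local ring at \<open>P\<close> onto the one at \<open>Q\<close>
  and preserves intersection multiplicities; since \<open>\<psi>\<close> preserves \<open>C\<close>, the image of \<open>\<Gamma>P\<close> osculates \<open>C\<close>
  at \<open>Q\<close>, so it is \<open>\<Gamma>Q\<close> by uniqueness. As \<open>\<psi>\<close> fixes \<open>L\<close> pointwise, \<open>\<Gamma>P\<close> and its image meet \<open>L\<close> in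
  the same points.\<close>

section \<open>Evaluation homomorphisms\<close>

text \<open>Two instances matter: the identity on coefficients gives evaluation at a vector, and
  \<open>const3\<close> gives substitution of polynomials. Both obtain the homomorphism laws from
  one proof.\<close>

locale coeff_hom =
  fixes h :: "complex \<Rightarrow> 'a::comm_semiring_1"
  assumes h_zero: "h 0 = 0" and h_one: "h 1 = 1"
    and h_add: "h (a + b) = h a + h b" and h_mult: "h (a * b) = h a * h b"
begin

abbreviation mon :: "(3 \<Rightarrow> 'a) \<Rightarrow> (3 \<Rightarrow>\<^sub>0 nat) \<Rightarrow> 'a" where
  "mon x m \<equiv> (\<Prod>i\<in>UNIV. x i ^ Poly_Mapping.lookup m i)"

text \<open>The sum in \<open>insertion\<close> runs over the support, which varies with the
  polynomial. Since \<open>h 0 = 0\<close>, it may be taken over any larger finite set, so two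
  polynomials can share an index set.\<close>

lemma insertion_superset:
  assumes "finite S" "Poly_Mapping.keys F \<subseteq> S"
  shows "insertion h x F = (\<Sum>m\<in>S. h (Poly_Mapping.lookup F m) * mon x m)"
  unfolding insertion_def
  by (rule sum.mono_neutral_left) (use assms in \<open>auto simp: h_zero in_keys_iff\<close>)

lemma insertion_zero [simp]: "insertion h x 0 = 0"
  by (simp add: insertion_def)

lemma insertion_single: "insertion h x (Poly_Mapping.single m c) = h c * mon x m"
  by (simp add: insertion_superset[of "{m}"])

lemma insertion_const [simp]: "insertion h x (const3 c) = h c"
  by (simp add: const3_def insertion_single)

lemma insertion_one [simp]: "insertion h x 1 = 1"
  by (metis const3_1 insertion_const h_one)

lemma insertion_add: "insertion h x (F + G) = insertion h x F + insertion h x G"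
proof -
  let ?S = "Poly_Mapping.keys F \<union> Poly_Mapping.keys G"
  have "Poly_Mapping.keys (F + G) \<subseteq> ?S" by (rule keys_add)
  then show ?thesis
    by (simp add: insertion_superset[of ?S] lookup_add h_add distrib_right sum.distrib)
qed

lemma insertion_sum: "insertion h x (sum f A) = (\<Sum>a\<in>A. insertion h x (f a))"
  by (induction A rule: infinite_finite_induct) (simp_all add: insertion_add)

end

lemma poly3_sum_singles:
  fixes F :: poly3
  assumes "finite S" "Poly_Mapping.keys F \<subseteq> S"
  shows "F = (\<Sum>m\<in>S. Poly_Mapping.single m (Poly_Mapping.lookup F m))"
proof (rule poly_mapping_eqI)
  fix k
  show "Poly_Mapping.lookup F k =
      Poly_Mapping.lookup (\<Sum>m\<in>S. Poly_Mapping.single m (Poly_Mapping.lookup F m)) k"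
    using assms by (auto simp: lookup_sum lookup_single when_def sum.delta in_keys_iff)
qed

context coeff_hom
begin

lemma insertion_mult: "insertion h x (F * G) = insertion h x F * insertion h x G"
proof -
  \<comment> \<open>On monomials multiplicativity is the law of exponents; bilinearity gives the
    general case once both factors are expanded into monomials.\<close>
  have single: "insertion h x (Poly_Mapping.single m c * Poly_Mapping.single n d) =
      insertion h x (Poly_Mapping.single m c) * insertion h x (Poly_Mapping.single n d)" for m n c d
    by (simp add: mult_single insertion_single h_mult lookup_add power_add prod.distrib mult_ac)
  have F: "F = (\<Sum>m\<in>Poly_Mapping.keys F. Poly_Mapping.single m (Poly_Mapping.lookup F m))"
    by (rule poly3_sum_singles) auto
  have G: "G = (\<Sum>m\<in>Poly_Mapping.keys G. Poly_Mapping.single m (Poly_Mapping.lookup G m))"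
    by (rule poly3_sum_singles) auto
  show ?thesis
    by (subst (1 2) F, subst (1 2) G)
      (simp add: sum_product insertion_sum single)
qed

lemma insertion_power: "insertion h x (F ^ k) = insertion h x F ^ k"
  by (induction k) (simp_all add: insertion_mult)

lemma insertion_prod: "insertion h x (prod f A) = (\<Prod>a\<in>A. insertion h x (f a))"
  by (induction A rule: infinite_finite_induct) (simp_all add: insertion_mult)

end

interpretation eval: coeff_hom "\<lambda>c. c"
  by unfold_locales auto

interpretation subst: coeff_hom const3
  by unfold_locales (simp_all add: const3_eq_0_iff const3_1 const3_mult, simp add: const3_def single_add)

lemma const3_sum: "const3 (sum f A) = (\<Sum>a\<in>A. const3 (f a))"
  by (induction A rule: infinite_finite_induct) (simp_all add: subst.h_zero subst.h_add)

definition var3 :: "3 \<Rightarrow> poly3" where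
  "var3 i = Poly_Mapping.single (Poly_Mapping.single i 1) 1"

context coeff_hom
begin

lemma insertion_var [simp]: "insertion h x (var3 i) = x i"
proof -
  have "mon x (Poly_Mapping.single i 1) = x i"
    by (simp add: lookup_single when_def if_distrib prod.delta cong: if_cong)
  then show ?thesis by (simp add: var3_def insertion_single h_one)
qed

text \<open>Insertion is a ring homomorphism, so it passes through the sum of products that defines
  the substitution. For evaluation this is composition of polynomial maps.\<close>

lemma insertion_psubst:
  "insertion h x (psubst G F) = insertion h (\<lambda>i. insertion h x (G i)) F"
  unfolding psubst_def insertion_def[of const3]
  by (simp add: insertion_sum insertion_mult insertion_prod insertion_power insertion_def[of h _ F])

end

lemma peval_psubst: "peval (psubst G F) v = peval F (\<chi> i. peval (G i) v)"
  by (simp add: peval_def eval.insertion_psubst)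

text \<open>Associativity of substitution is \<open>insertion_psubst\<close> with coefficient map
  \<open>const3\<close>. The inner \<open>psubst H F\<close> stays folded so that this instance
  matches.\<close>

lemma psubst_psubst: "psubst G (psubst H F) = psubst (\<lambda>i. psubst G (H i)) F"
  unfolding psubst_def[of G] psubst_def[of "\<lambda>i. insertion const3 G (H i)"]
  by (rule subst.insertion_psubst)

lemma psubst_var: "psubst var3 F = F"
proof -
  have pow: "var3 i ^ k = Poly_Mapping.single (Poly_Mapping.single i k) 1" for i k
    by (induction k) (simp_all add: var3_def mult_single flip: single_add)
  have prod: "(\<Prod>i\<in>A. var3 i ^ f i) = Poly_Mapping.single (\<Sum>i\<in>A. Poly_Mapping.single i (f i)) 1"
    if "finite A" for A f
    using that by (induction A) (simp_all add: pow mult_single)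
  have exponents: "(\<Sum>i\<in>UNIV. Poly_Mapping.single i (Poly_Mapping.lookup m i)) = m" for m :: "3 \<Rightarrow>\<^sub>0 nat"
    by (rule poly_mapping_eqI) (simp add: lookup_sum lookup_single when_def sum.delta)
  have "psubst var3 F = (\<Sum>m\<in>Poly_Mapping.keys F. Poly_Mapping.single m (Poly_Mapping.lookup F m))"
    by (simp add: psubst_def insertion_def prod exponents const3_def mult_single)
  also have "\<dots> = F" by (rule poly3_sum_singles[symmetric]) auto
  finally show ?thesis .
qed

section \<open>Forms\<close>

lemma homogeneous_0 [simp]: "homogeneous d 0"
  by (simp add: homogeneous_def)

lemma homogeneous_add: "homogeneous d F \<Longrightarrow> homogeneous d G \<Longrightarrow> homogeneous d (F + G)"
  using keys_add[of F G] unfolding homogeneous_def by blast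

lemma homogeneous_sum: "(\<And>a. a \<in> A \<Longrightarrow> homogeneous d (f a)) \<Longrightarrow> homogeneous d (sum f A)"
  by (induction A rule: infinite_finite_induct) (auto simp: homogeneous_add)

lemma homogeneous_mult:
  assumes "homogeneous d F" "homogeneous e G"
  shows "homogeneous (d + e) (F * G)"
  unfolding homogeneous_def
proof
  fix m assume "m \<in> Poly_Mapping.keys (F * G)"
  then obtain a b where "m = a + b" "a \<in> Poly_Mapping.keys F" "b \<in> Poly_Mapping.keys G"
    using keys_mult[of F G] by blast
  then show "(\<Sum>i\<in>UNIV. Poly_Mapping.lookup m i) = d + e"
    using assms by (simp add: homogeneous_def lookup_add sum.distrib)
qed

lemma homogeneous_const: "homogeneous 0 (const3 c)"
  by (simp add: homogeneous_def const3_def)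

lemma homogeneous_one: "homogeneous 0 1"
  using homogeneous_const[of 1] by (simp add: const3_1)

lemma homogeneous_power: "homogeneous d F \<Longrightarrow> homogeneous (k * d) (F ^ k)"
  by (induction k) (auto simp: homogeneous_one homogeneous_mult)

lemma homogeneous_prod:
  "(\<And>a. a \<in> A \<Longrightarrow> homogeneous (d a) (f a)) \<Longrightarrow> homogeneous (sum d A) (prod f A)"
  by (induction A rule: infinite_finite_induct) (auto simp: homogeneous_one homogeneous_mult)

lemma homogeneous_var: "homogeneous 1 (var3 i)"
  by (simp add: homogeneous_def var3_def lookup_single when_def)

lemma homogeneous_psubst:
  assumes "homogeneous d F" "\<And>i. homogeneous 1 (G i)"
  shows "homogeneous d (psubst G F)"
  unfolding psubst_def insertion_def
proof (rule homogeneous_sum)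
  fix m assume "m \<in> Poly_Mapping.keys F"
  \<comment> \<open>The degree is split as the rules for a constant, a product and powers of linear
    forms will produce it.\<close>
  then have "d = 0 + (\<Sum>i\<in>UNIV. Poly_Mapping.lookup m i * 1)"
    using assms(1) by (simp add: homogeneous_def)
  then show "homogeneous d (const3 (Poly_Mapping.lookup F m) * (\<Prod>i\<in>UNIV. G i ^ Poly_Mapping.lookup m i))"
    by (metis (no_types, lifting) homogeneous_mult homogeneous_const homogeneous_prod homogeneous_power assms(2))
qed

lemma homogeneous_unique:
  assumes "F \<noteq> 0" "homogeneous d F" "homogeneous e F"
  shows "d = e"
proof -
  obtain m where "m \<in> Poly_Mapping.keys F" using assms(1) by (metis all_not_in_conv keys_eq_empty)
  then show ?thesis using assms by (auto simp: homogeneous_def)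
qed

lemma peval_scale:
  assumes "homogeneous d F"
  shows "peval F (c *s v) = c ^ d * peval F v"
proof -
  have "(\<Prod>i\<in>UNIV. (c *s v) $ i ^ Poly_Mapping.lookup m i) =
      c ^ d * (\<Prod>i\<in>UNIV. v $ i ^ Poly_Mapping.lookup m i)" if "m \<in> Poly_Mapping.keys F" for m
  proof -
    have "(\<Sum>i\<in>UNIV. Poly_Mapping.lookup m i) = d" using assms that by (simp add: homogeneous_def)
    then show ?thesis
      by (auto simp: power_mult_distrib prod.distrib simp flip: power_sum)
  qed
  then show ?thesis
    by (simp add: peval_def insertion_def sum_distrib_left mult_ac)
qed

lemma peval_zero [simp]: "peval 0 v = 0"
  by (simp add: peval_def)

lemma peval_const_mult: "peval (const3 c * F) v = c * peval F v"
  by (simp add: peval_def eval.insertion_mult)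

text \<open>Along a polynomially parametrised curve a form becomes a polynomial in one variable, to
  which the fundamental theorem of algebra applies.\<close>

lemma peval_poly: "\<exists>p. \<forall>t. peval F (\<chi> i. poly (q i) t) = poly p t"
proof (intro exI allI)
  fix t
  show "peval F (\<chi> i. poly (q i) t) = poly (\<Sum>m\<in>Poly_Mapping.keys F.
      smult (Poly_Mapping.lookup F m) (\<Prod>i\<in>UNIV. q i ^ Poly_Mapping.lookup m i)) t"
    by (simp add: peval_def insertion_def poly_sum poly_prod)
qed

section \<open>Linear substitutions\<close>

text \<open>The forms are the rows of \<open>M\<close>, that is, the coordinates of
  \<open>M *v v\<close>. Hence \<open>lsub M\<close> is the pull-back of polynomials along the
  linear map of \<open>M\<close>.\<close>

definition lin :: "complex ^ 3 ^ 3 \<Rightarrow> 3 \<Rightarrow> poly3" where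
  "lin M i = (\<Sum>j\<in>UNIV. const3 (M $ i $ j) * var3 j)"

abbreviation lsub :: "complex ^ 3 ^ 3 \<Rightarrow> poly3 \<Rightarrow> poly3" where
  "lsub M \<equiv> psubst (lin M)"

lemma homogeneous_lin: "homogeneous 1 (lin M i)"
  unfolding lin_def
  by (intro homogeneous_sum homogeneous_const3_mult homogeneous_var)

lemma linear_form_eq_lin:
  assumes "homogeneous 1 F"
  shows "F = (\<Sum>j\<in>UNIV. const3 (Poly_Mapping.lookup F (Poly_Mapping.single j 1)) * var3 j)"
proof -
  let ?s = "\<lambda>j::3. Poly_Mapping.single j (1::nat)"
  have inj: "inj ?s"
    by (rule injI) (metis lookup_single_eq lookup_single_not_eq zero_neq_one)
  have "Poly_Mapping.keys F \<subseteq> range ?s"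
  proof
    fix m assume "m \<in> Poly_Mapping.keys F"
    then have sum1: "(\<Sum>i\<in>UNIV. Poly_Mapping.lookup m i) = 1"
      using assms by (simp add: homogeneous_def)
    \<comment> \<open>Natural numbers with sum 1 are all 0 except for a single 1, so the exponent
      vector is a unit vector.\<close>
    then obtain j where j: "Poly_Mapping.lookup m j = 1"
      "\<And>i. i \<noteq> j \<Longrightarrow> Poly_Mapping.lookup m i = 0"
      by (auto simp: sum_eq_Suc0_iff)
    then have "m = ?s j" by (intro poly_mapping_eqI) (auto simp: lookup_single when_def)
    then show "m \<in> range ?s" by blast
  qed
  then have "F = (\<Sum>m\<in>range ?s. Poly_Mapping.single m (Poly_Mapping.lookup F m))"
    by (intro poly3_sum_singles) auto
  also have "\<dots> = (\<Sum>j\<in>UNIV. Poly_Mapping.single (?s j) (Poly_Mapping.lookup F (?s j)))"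
    by (simp only: sum.reindex[OF inj] o_def)
  finally show ?thesis by (simp add: const3_def var3_def mult_single)
qed

lemma linear_forms_eq_lin:
  assumes "\<And>i. homogeneous 1 (G i)"
  obtains M where "G = lin M"
proof
  show "G = lin (\<chi> i j. Poly_Mapping.lookup (G i) (Poly_Mapping.single j 1))"
    using linear_form_eq_lin[OF assms] by (auto simp: lin_def fun_eq_iff)
qed

lemma peval_lin: "(\<chi> i. peval (lin M i) v) = M *v v"
  by (simp add: peval_def lin_def eval.insertion_sum eval.insertion_mult matrix_vector_mult_def vec_eq_iff)

lemma peval_lsub: "peval (lsub M F) v = peval F (M *v v)"
  by (simp add: peval_psubst peval_lin)

text \<open>Pull-back is contravariant, so the order of the matrices is reversed.\<close>

lemma lsub_lsub: "lsub M (lsub N F) = lsub (N ** M) F"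
proof -
  have "lsub M (lin N i) = lin (N ** M) i" for i
  proof -
    have "lsub M (lin N i) = (\<Sum>j\<in>UNIV. const3 (N $ i $ j) * (\<Sum>k\<in>UNIV. const3 (M $ j $ k) * var3 k))"
      by (simp add: psubst_def lin_def[of N] subst.insertion_sum subst.insertion_mult) (simp add: lin_def)
    also have "\<dots> = (\<Sum>k\<in>UNIV. \<Sum>j\<in>UNIV. const3 (N $ i $ j * M $ j $ k) * var3 k)"
      by (subst sum.swap) (simp add: sum_distrib_left const3_mult flip: mult.assoc)
    also have "\<dots> = lin (N ** M) i"
      by (simp add: lin_def matrix_matrix_mult_def const3_sum sum_distrib_right)
    finally show ?thesis .
  qed
  then show ?thesis by (simp add: psubst_psubst)
qed

lemma lsub_id: "lsub (mat 1) F = F"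
proof -
  have "lin (mat 1) = var3"
    by (auto simp: lin_def mat_def fun_eq_iff if_distrib[of const3] if_distrib[of "\<lambda>a. a * _"]
        subst.h_zero subst.h_one cong: if_cong)
  then show ?thesis by (simp add: psubst_var)
qed

lemma lsub_inverse: "N ** M = mat 1 \<Longrightarrow> lsub M (lsub N F) = F"
  by (simp add: lsub_lsub lsub_id)

lemma lsub_add: "lsub M (F + G) = lsub M F + lsub M G"
  by (simp add: psubst_def subst.insertion_add)

lemma lsub_mult: "lsub M (F * G) = lsub M F * lsub M G"
  by (simp add: psubst_def subst.insertion_mult)

lemma lsub_const [simp]: "lsub M (const3 c) = const3 c"
  by (simp add: psubst_def)

lemma lsub_one [simp]: "lsub M 1 = 1"
  by (simp add: psubst_def)

lemma lsub_zero [simp]: "lsub M 0 = 0"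
  by (simp add: psubst_def)

lemma homogeneous_lsub: "homogeneous d F \<Longrightarrow> homogeneous d (lsub M F)"
  by (rule homogeneous_psubst[OF _ homogeneous_lin])

section \<open>Points and curves\<close>

lemma proj_rel_refl: "proj_rel v v \<longleftrightarrow> v \<noteq> 0"
  by (auto simp: proj_rel_def intro!: exI[of _ 1])

lemma proj_pt_eq_iff:
  assumes "v \<noteq> 0" "w \<noteq> 0"
  shows "proj_pt v = proj_pt w \<longleftrightarrow> (\<exists>c. c \<noteq> 0 \<and> w = c *s v)"
  using Quotient3_rel[OF Quotient3_proj_plane, of v w] assms
  by (auto simp: proj_rel_refl) (auto simp: proj_rel_def)

lemma coords_nonzero: "coords p \<noteq> 0"
  using Quotient3_rep_reflp[OF Quotient3_proj_plane, of p] by (simp add: proj_rel_refl)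

lemma proj_pt_coords [simp]: "proj_pt (coords p) = p"
  by (rule Quotient3_abs_rep[OF Quotient3_proj_plane])

lemma coords_proj_pt:
  assumes "v \<noteq> 0"
  obtains c where "c \<noteq> 0" "coords (proj_pt v) = c *s v"
  using proj_pt_eq_iff[OF assms coords_nonzero] proj_pt_coords by metis

lemma curve_eqn_rel: "curve_rel (curve_eqn C) (curve_eqn C)"
  by (rule Quotient3_rep_reflp[OF Quotient3_plane_curve])

lemma curve_eqn_nonzero: "curve_eqn C \<noteq> 0"
  using curve_eqn_rel[of C] by (simp add: curve_rel_def)

text \<open>The equation of a curve is nonzero, so its degree is unique and the description in
  \<open>curve_degree\<close> denotes it.\<close>

lemma homogeneous_curve_eqn_iff: "homogeneous d (curve_eqn C) \<longleftrightarrow> d = curve_degree C"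
proof -
  obtain e where e: "homogeneous e (curve_eqn C)" using curve_eqn_rel[of C] by (auto simp: curve_rel_def)
  then have "curve_degree C = e"
    unfolding curve_degree_def using homogeneous_unique[OF curve_eqn_nonzero] by blast
  then show ?thesis using e homogeneous_unique[OF curve_eqn_nonzero] by blast
qed

lemma curve_degree_pos: "curve_degree C > 0"
  using curve_eqn_rel[of C] by (auto simp: curve_rel_def homogeneous_curve_eqn_iff)

text \<open>The representative chosen by the quotient recovers \<open>F\<close> only up to a
  constant. This is the source of the constants in later relations between equations.\<close>

lemma curve_eqn_curve_of:
  assumes "F \<noteq> 0" "homogeneous d F" "d > 0"
  obtains c where "c \<noteq> 0" "curve_eqn (curve_of F) = const3 c * F"
proof -
  have "curve_rel F F" using assms unfolding curve_rel_def by (metis const3_1 mult_1 zero_neq_one)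
  then have "curve_rel F (curve_eqn (curve_of F))"
    by (metis Quotient3_rep_abs[OF Quotient3_plane_curve] Quotient3_symp[OF Quotient3_plane_curve] sympD)
  then show ?thesis using that by (auto simp: curve_rel_def)
qed

section \<open>Automorphisms of the plane are linear\<close>

text \<open>On \<open>(1, t, 0)\<close> and on \<open>(t, 1, 0)\<close> the factor of proportionality is a polynomial in \<open>t\<close> without
  zeros, hence constant. Comparing the two at \<open>(2, 1, 0) = 2 (1, 1/2, 0)\<close> gives \<open>2\<^sup>N = 2\<close>.\<close>

lemma composite_degree_1:
  fixes F :: "3 \<Rightarrow> poly3" and K :: "complex ^ 3 \<Rightarrow> complex ^ 3"
  assumes K: "\<And>v. K v = (\<chi> i. peval (F i) v)"
    and scale: "\<And>c v. K (c *s v) = c ^ N *s K v"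
    and parallel: "\<And>v. v \<noteq> 0 \<Longrightarrow> \<exists>l. l \<noteq> 0 \<and> K v = l *s v"
  shows "N = 1"
proof -
  define a where "a t = (vector [1, t, 0] :: complex ^ 3)" for t
  define b where "b t = (vector [t, 1, 0] :: complex ^ 3)" for t
  have const: "f x = f y"
    if "\<And>t. f t \<noteq> 0" "\<exists>p. \<forall>t. f t = poly p t" for f :: "complex \<Rightarrow> complex" and x y
  proof -
    obtain p where p: "\<And>t. f t = poly p t" using \<open>\<exists>p. \<forall>t. f t = poly p t\<close> by blast
    then have "constant (poly p)" using that(1) fundamental_theorem_of_algebra[of p] by auto
    then show ?thesis by (simp add: constant_def p)
  qed
  have a_ne: "a t \<noteq> 0" and b_ne: "b t \<noteq> 0" for t
    by (auto simp: a_def b_def vec_eq_iff forall_3)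
  have a_poly: "a t = (\<chi> i. poly ((vector [1, [:0, 1:], 0] :: complex poly ^ 3) $ i) t)" for t
    by (simp add: a_def vec_eq_iff forall_3)
  have b_poly: "b t = (\<chi> i. poly ((vector [[:0, 1:], 1, 0] :: complex poly ^ 3) $ i) t)" for t
    by (simp add: b_def vec_eq_iff forall_3)
  \<comment> \<open>The first coordinate of \<open>a t\<close> is 1, so this coordinate of
    \<open>K (a t)\<close> is the factor of proportionality itself; for \<open>b t\<close> the
    second coordinate plays that part.\<close>
  have "K (a t) $ 1 \<noteq> 0" for t
    using parallel[OF a_ne[of t]] by (auto simp: a_def)
  moreover have "\<exists>p. \<forall>t. K (a t) $ 1 = poly p t"
    by (simp only: K a_poly vec_lambda_beta peval_poly)
  ultimately have Ka: "K (a t) $ 1 = K (a 1) $ 1" for t by (rule const)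
  have "K (b t) $ 2 \<noteq> 0" for t
    using parallel[OF b_ne[of t]] by (auto simp: b_def)
  moreover have "\<exists>p. \<forall>t. K (b t) $ 2 = poly p t"
    by (simp only: K b_poly vec_lambda_beta peval_poly)
  ultimately have Kb: "K (b t) $ 2 = K (b 1) $ 2" for t by (rule const)
  have ab: "a 1 = b 1" by (simp add: a_def b_def)
  have "K (b 2) $ 1 = 2 * K (b 2) $ 2"
    using parallel[OF b_ne[of 2]] by (auto simp: b_def)
  moreover have "K (b 1) $ 1 = K (b 1) $ 2" "K (b 1) $ 1 \<noteq> 0"
    using parallel[OF b_ne[of 1]] by (auto simp: b_def)
  moreover have "b 2 = 2 *s a (1/2)" by (simp add: a_def b_def vec_eq_iff forall_3)
  then have "K (b 2) $ 1 = 2 ^ N * K (b 1) $ 1"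
    by (simp add: scale Ka[of "1/2"] ab)
  ultimately have "(2::complex) ^ N = 2 ^ 1" using Kb[of 2] by simp
  \<comment> \<open>Powers of 2 are compared in the natural numbers, where the exponent is
    determined.\<close>
  then have "(of_nat (2 ^ N) :: complex) = of_nat (2 ^ 1)" by simp
  then have "(2::nat) ^ N = 2 ^ 1" by (simp only: of_nat_eq_iff)
  then show ?thesis by (subst (asm) power_inject_exp) auto
qed

text \<open>The inverse matrix \<open>N\<close> is carried along explicitly because curves are
  pushed forward by pulling their equations back along \<open>N\<close>.\<close>

definition lifted_by :: "(proj_plane \<Rightarrow> proj_plane) \<Rightarrow> complex ^ 3 ^ 3 \<Rightarrow> complex ^ 3 ^ 3 \<Rightarrow> bool" where
  "lifted_by f M N \<longleftrightarrow> M ** N = mat 1 \<and> N ** M = mat 1 \<and>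
     (\<forall>v. v \<noteq> 0 \<longrightarrow> f (proj_pt v) = proj_pt (M *v v))"

lemma lifted_by_vec:
  assumes "lifted_by f M N"
  shows "M *v (N *v v) = v" "N *v (M *v v) = v" "v \<noteq> 0 \<Longrightarrow> M *v v \<noteq> 0" "v \<noteq> 0 \<Longrightarrow> N *v v \<noteq> 0"
proof -
  show MN: "M *v (N *v v) = v" and NM: "N *v (M *v v) = v"
    using assms by (simp_all add: lifted_by_def matrix_vector_mul_assoc)
  show "v \<noteq> 0 \<Longrightarrow> M *v v \<noteq> 0" "v \<noteq> 0 \<Longrightarrow> N *v v \<noteq> 0"
    using MN NM by (metis matrix_vector_mult_0_right)+
qed

lemma lifted_by_inv:
  assumes "lifted_by f M N" "bij f"
  shows "lifted_by (inv f) N M"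
proof -
  have "inv f (proj_pt v) = proj_pt (N *v v)" if "v \<noteq> 0" for v
  proof (rule inv_f_eq)
    show "inj f" using \<open>bij f\<close> by (rule bij_is_inj)
    show "f (proj_pt (N *v v)) = proj_pt v"
      using assms(1) that lifted_by_vec[OF assms(1)] by (auto simp: lifted_by_def)
  qed
  then show ?thesis using assms by (simp add: lifted_by_def)
qed

lemma lifted_by_comp:
  assumes "lifted_by f M N" "lifted_by g M' N'"
  shows "lifted_by (f \<circ> g) (M ** M') (N' ** N)"
proof -
  have "(M ** M') ** (N' ** N) = M ** (M' ** N') ** N" "(N' ** N) ** (M ** M') = N' ** (N ** M) ** M'"
    by (simp_all add: matrix_mul_assoc)
  then show ?thesis
    using assms lifted_by_vec(3)[OF assms(2)] by (simp add: lifted_by_def matrix_vector_mul_assoc)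
qed

lemma lifted_by_id: "lifted_by id (mat 1) (mat 1)"
  by (simp add: lifted_by_def)

text \<open>Forms for \<open>f\<close> and for its inverse compose to forms of degree
  \<open>d * e\<close> that represent the identity, which forces \<open>d * e = 1\<close>. The forms
  \<open>H\<close> are arbitrary, so that the ones picked by \<open>SOME\<close> in
  \<open>curve_image\<close> are covered.\<close>

lemma automorphism_lifted_by:
  assumes aut: "plane_automorphism f" and H: "represents H (inv f)"
  obtains M N where "H = lin N" "lifted_by f M N"
proof -
  from aut have "bij f" by (simp add: plane_automorphism_def)
  from aut obtain G where G: "represents G f" by (auto simp: plane_automorphism_def plane_morphism_def)
  from G obtain d where d: "\<And>i. homogeneous d (G i)"
    and G_ne: "\<And>v. v \<noteq> 0 \<Longrightarrow> (\<chi> i. peval (G i) v) \<noteq> 0"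
    and G_f: "\<And>v. v \<noteq> 0 \<Longrightarrow> f (proj_pt v) = proj_pt (\<chi> i. peval (G i) v)"
    by (auto simp: represents_def vec_eq_iff)
  from H obtain e where e: "\<And>i. homogeneous e (H i)"
    and H_ne: "\<And>v. v \<noteq> 0 \<Longrightarrow> (\<chi> i. peval (H i) v) \<noteq> 0"
    and H_f: "\<And>v. v \<noteq> 0 \<Longrightarrow> inv f (proj_pt v) = proj_pt (\<chi> i. peval (H i) v)"
    by (auto simp: represents_def vec_eq_iff)
  define K where "K v = (\<chi> i. peval (psubst G (H i)) v)" for v
  have "d * e = 1"
  proof (rule composite_degree_1[OF K_def])
    fix c v
    have "(\<chi> i. peval (G i) (c *s v)) = c ^ d *s (\<chi> i. peval (G i) v)"
      by (simp add: vec_eq_iff peval_scale[OF d])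
    then have "peval (psubst G (H i)) (c *s v) = c ^ (d * e) * peval (psubst G (H i)) v" for i
      by (simp only: peval_psubst peval_scale[OF e] power_mult)
    then show "K (c *s v) = c ^ (d * e) *s K v"
      by (simp add: K_def vec_eq_iff)
  next
    fix v :: "complex ^ 3" assume v: "v \<noteq> 0"
    have "inv f (f (proj_pt v)) = proj_pt (K v)"
      using G_f[OF v] H_f[OF G_ne[OF v]] by (simp add: K_def peval_psubst)
    then have "proj_pt v = proj_pt (K v)" using \<open>bij f\<close> by (simp add: bij_is_inj)
    moreover have "K v \<noteq> 0" using H_ne[OF G_ne[OF v]] by (simp add: K_def peval_psubst)
    ultimately show "\<exists>l. l \<noteq> 0 \<and> K v = l *s v" using proj_pt_eq_iff[OF v] by simp
  qed
  then have "e = 1" by simp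
  with e obtain N where N: "H = lin N" using linear_forms_eq_lin by metis
  have N_ne: "N *v v \<noteq> 0" if "v \<noteq> 0" for v using H_ne[OF that] by (simp add: N peval_lin)
  have N_f: "inv f (proj_pt v) = proj_pt (N *v v)" if "v \<noteq> 0" for v
    using H_f[OF that] by (simp add: N peval_lin)
  \<comment> \<open>Having no common zero means that \<open>N\<close> has trivial kernel. This gives
    a left inverse, which is two-sided for square matrices.\<close>
  have "inj ((*v) N)"
    by (rule injI) (metis N_ne eq_iff_diff_eq_0 matrix_vector_mult_diff_distrib)
  then obtain M where "M ** N = mat 1" using matrix_left_invertible_injective by blast
  then have "lifted_by (inv f) N M" using N_f by (simp add: lifted_by_def matrix_left_right_inverse)
  then have "lifted_by f M N" using lifted_by_inv[of "inv f"] \<open>bij f\<close>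
    by (simp add: bij_imp_bij_inv inv_inv_eq)
  with N show ?thesis by (rule that)
qed

section \<open>Linear symmetries of a curve\<close>

text \<open>Semi-invariance up to a nonzero constant is the right notion, as a curve determines its
  equation only up to such a factor.\<close>

definition linear_symmetry :: "poly3 \<Rightarrow> (proj_plane \<Rightarrow> proj_plane) \<Rightarrow> bool" where
  "linear_symmetry F f \<longleftrightarrow> (\<exists>M N c. lifted_by f M N \<and> c \<noteq> 0 \<and> lsub M F = const3 c * F)"

lemma semi_invariant_inverse:
  assumes "M ** N = mat 1" "c \<noteq> 0" "lsub M F = const3 c * F"
  shows "lsub N F = const3 (inverse c) * F"
proof -
  \<comment> \<open>Pulling the assumed relation back along \<open>N\<close> cancels
    \<open>lsub M\<close> and leaves constants fixed.\<close>
  have "F = const3 c * lsub N F"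
    using lsub_inverse[OF assms(1), of F] assms(3) by (simp add: lsub_mult)
  then have "const3 (inverse c) * F = const3 (inverse c * c) * lsub N F"
    by (metis mult.assoc const3_mult)
  then show ?thesis using assms(2) by (simp add: const3_1)
qed

lemma linear_symmetry_inv:
  assumes "linear_symmetry F f" "bij f"
  shows "linear_symmetry F (inv f)"
proof -
  obtain M N c where *: "lifted_by f M N" "c \<noteq> 0" "lsub M F = const3 c * F"
    using assms(1) unfolding linear_symmetry_def by blast
  then have "lsub N F = const3 (inverse c) * F"
    by (intro semi_invariant_inverse) (auto simp: lifted_by_def)
  moreover have "inverse c \<noteq> 0" using *(2) by simp
  ultimately show ?thesis
    using lifted_by_inv[OF *(1) assms(2)] unfolding linear_symmetry_def by blast
qed

lemma linear_symmetry_comp: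
  assumes "linear_symmetry F f" "linear_symmetry F g"
  shows "linear_symmetry F (f \<circ> g)"
proof -
  obtain M N c M' N' c' where *: "lifted_by f M N" "c \<noteq> 0" "lsub M F = const3 c * F"
    "lifted_by g M' N'" "c' \<noteq> 0" "lsub M' F = const3 c' * F"
    using assms unfolding linear_symmetry_def by blast
  have "lsub (M ** M') F = const3 (c * c') * F"
    using * by (simp add: lsub_mult mult_ac flip: lsub_lsub const3_mult)
  then show ?thesis
    using * lifted_by_comp[OF *(1,4)] unfolding linear_symmetry_def by (metis mult_eq_0_iff)
qed

lemma linear_symmetry_funpow: "linear_symmetry F f \<Longrightarrow> linear_symmetry F (f ^^ k)"
proof (induction k)
  case 0
  show ?case
    unfolding linear_symmetry_def using lifted_by_id lsub_id[of F]
    by (intro exI[of _ "mat 1"] exI[of _ 1]) (auto simp: const3_1 id_def)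
next
  case (Suc k)
  then show ?case using linear_symmetry_comp by (simp only: funpow.simps(2))
qed

text \<open>Linear symmetries are closed under composition and inversion; negative exponents are
  powers of \<open>inv f\<close>.\<close>

lemma linear_symmetry_int_iterate:
  assumes "linear_symmetry F f" "bij f"
  shows "linear_symmetry F (int_iterate f k)"
  using linear_symmetry_funpow[OF assms(1)] linear_symmetry_funpow[OF linear_symmetry_inv[OF assms]]
  by (simp only: int_iterate_def split: if_split) blast

lemma int_iterate_fixed:
  assumes "f x = x" "bij f"
  shows "int_iterate f k x = x"
proof -
  have pow: "(g ^^ k) x = x" if "g x = x" for g :: "'a \<Rightarrow> 'a" and k
  proof (induction k)
    case (Suc k)
    then show ?case using that by (simp only: funpow.simps(2) comp_apply)
  qed (simp only: funpow.simps(1) id_apply)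
  have "inv f x = x" using assms by (metis bij_is_inj inv_f_f)
  then show ?thesis using pow assms by (simp add: int_iterate_def)
qed

lemma linear_symmetry_of_invariant_curve:
  assumes aut: "plane_automorphism f" and "invariant_curve f C"
  shows "linear_symmetry (curve_eqn C) f"
proof -
  define H where "H = (SOME G. represents G (inv f))"
  from aut have "\<exists>G. represents G (inv f)" by (simp add: plane_automorphism_def plane_morphism_def)
  then have "represents H (inv f)" unfolding H_def by (rule someI_ex)
  then obtain M N where H: "H = lin N" and f: "lifted_by f M N"
    using automorphism_lifted_by[OF aut] by blast
  let ?F = "curve_eqn C"
  have inv: "N ** M = mat 1" "M ** N = mat 1" using f by (auto simp: lifted_by_def)
  have "lsub N ?F \<noteq> 0" using lsub_inverse[OF inv(1), of ?F] curve_eqn_nonzero[of C] by auto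
  moreover have "homogeneous (curve_degree C) (lsub N ?F)"
    by (simp add: homogeneous_lsub homogeneous_curve_eqn_iff)
  ultimately obtain c where c: "c \<noteq> 0" "curve_eqn (curve_of (lsub N ?F)) = const3 c * lsub N ?F"
    using curve_eqn_curve_of curve_degree_pos by metis
  have "curve_of (lsub N ?F) = C"
    using assms(2) by (simp add: invariant_curve_def curve_image_def flip: H_def H)
  with c have "?F = const3 c * lsub N ?F" by simp
  \<comment> \<open>Invariance is a relation for the inverse matrix \<open>N\<close>; applying
    \<open>lsub M\<close> to both sides turns it into one for \<open>M\<close>.\<close>
  then have "lsub M ?F = const3 c * ?F"
    by (metis lsub_mult lsub_const lsub_inverse[OF inv(1)])
  with f c(1) show ?thesis by (auto simp: linear_symmetry_def)
qed

section \<open>Invariance of intersection multiplicities\<close>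

locale idom_embedding =
  fixes h :: "'a::idom \<Rightarrow> 'b::idom"
  assumes h_add: "h (a + b) = h a + h b" and h_mult: "h (a * b) = h a * h b"
    and h_inj: "h a = 0 \<Longrightarrow> a = 0"
begin

text \<open>This is the extension of \<open>h\<close> to fraction fields. The value is chosen from
  some representation with nonzero denominator; independence of the choice is
  \<open>fract_map_Fract\<close>.\<close>

definition fract_map :: "'a fract \<Rightarrow> 'b fract" where
  "fract_map q = (SOME r. \<exists>a b. b \<noteq> 0 \<and> q = Fract a b \<and> r = Fract (h a) (h b))"

lemma h_nonzero: "a \<noteq> 0 \<Longrightarrow> h a \<noteq> 0"
  using h_inj by blast

text \<open>Equality of fractions is a cross-multiplied identity, which \<open>h\<close> preserves,
  and injectivity keeps the denominators nonzero.\<close>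

lemma fract_map_Fract: "b \<noteq> 0 \<Longrightarrow> fract_map (Fract a b) = Fract (h a) (h b)"
  unfolding fract_map_def
proof (rule someI2_ex)
  fix r assume b: "b \<noteq> 0" and "\<exists>c d. d \<noteq> 0 \<and> Fract a b = Fract c d \<and> r = Fract (h c) (h d)"
  then obtain c d where *: "d \<noteq> 0" "a * d = c * b" "r = Fract (h c) (h d)"
    by (metis eq_fract(1))
  then have "h a * h d = h c * h b" by (metis h_mult)
  then show "r = Fract (h a) (h b)" using * b by (simp add: eq_fract(1) h_nonzero)
qed auto

lemma fract_map_add: "fract_map (p + q) = fract_map p + fract_map q"
  by (cases p rule: Fract_cases, cases q rule: Fract_cases)
    (simp add: fract_map_Fract h_add h_mult h_nonzero)

lemma fract_map_mult: "fract_map (p * q) = fract_map p * fract_map q"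
  by (cases p rule: Fract_cases, cases q rule: Fract_cases)
    (simp add: fract_map_Fract h_mult)

lemma fract_map_zero: "fract_map 0 = 0"
  by (metis fract_map_add add_0 add_cancel_right_left)

lemma fract_map_sum: "fract_map (sum f A) = (\<Sum>a\<in>A. fract_map (f a))"
  by (induction A rule: infinite_finite_induct) (simp_all add: fract_map_zero fract_map_add)

end

text \<open>The left inverse \<open>k\<close> of \<open>h\<close> turns linear relations modulo \<open>I'\<close> into relations modulo \<open>I\<close>, so
  \<open>h\<close> preserves linear independence.\<close>

lemma quotient_dim_le:
  assumes "\<And>b. k (h b) = b" "h ` R \<subseteq> R'" "k ` I' \<subseteq> I"
    and k_sum: "\<And>(f :: poly3 fract \<Rightarrow> poly3 fract) A. k (sum f A) = (\<Sum>a\<in>A. k (f a))"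
    and k_scale: "\<And>c b. k (Fract (const3 c) 1 * b) = Fract (const3 c) 1 * k b"
  shows "quotient_dim R I \<le> quotient_dim R' I'"
  unfolding quotient_dim_def
proof (rule SUP_least)
  fix B assume "B \<in> {B. finite B \<and> B \<subseteq> R \<and> independent_modulo I B}"
  then have B: "finite B" "B \<subseteq> R" "independent_modulo I B" by auto
  have inj: "inj_on h B" by (rule inj_on_inverseI[of _ k]) (rule assms(1))
  have "independent_modulo I' (h ` B)"
    unfolding independent_modulo_def
  proof (intro allI impI)
    fix c assume "(\<Sum>b\<in>h ` B. Fract (const3 (c b)) 1 * b) \<in> I'"
    then have "k (\<Sum>b\<in>h ` B. Fract (const3 (c b)) 1 * b) \<in> I" using assms(3) by blast
    also have "k (\<Sum>b\<in>h ` B. Fract (const3 (c b)) 1 * b) = (\<Sum>b\<in>B. Fract (const3 (c (h b))) 1 * b)"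
      by (simp only: sum.reindex[OF inj] o_def k_sum k_scale assms(1))
    finally show "\<forall>b\<in>h ` B. c b = 0"
      using B(3) unfolding independent_modulo_def by auto
  qed
  then have "h ` B \<in> {B. finite B \<and> B \<subseteq> R' \<and> independent_modulo I' B}"
    using B assms(2) by auto
  moreover have "card (h ` B) = card B" by (rule card_image[OF inj])
  ultimately show "enat (card B) \<le> (SUP B\<in>{B. finite B \<and> B \<subseteq> R' \<and> independent_modulo I' B}. enat (card B))"
    by (metis (mono_tags, lifting) SUP_upper)
qed

lemma idom_embedding_lsub: "M ** N = mat 1 \<Longrightarrow> idom_embedding (lsub M)"
  by unfold_locales (simp_all add: lsub_add lsub_mult, metis lsub_inverse lsub_zero)

text \<open>Local functions are carried from \<open>p\<close> to \<open>q\<close> by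
  \<open>lsub N\<close>, while the ideals at \<open>q\<close> are pulled back by
  \<open>lsub M\<close>. One inequality suffices, because osculation is a lower bound on the
  multiplicity.\<close>

lemma intersection_mult_le:
  assumes f: "lifted_by f M N" and "q = f p"
    and C: "lsub M (curve_eqn C') = const3 c * curve_eqn C"
    and D: "lsub M (curve_eqn D') = const3 d * curve_eqn D"
  shows "intersection_mult C D p \<le> intersection_mult C' D' q"
proof -
  have inv: "N ** M = mat 1" "M ** N = mat 1" using f by (auto simp: lifted_by_def)
  interpret m: idom_embedding "lsub M" by (rule idom_embedding_lsub[OF inv(2)])
  interpret n: idom_embedding "lsub N" by (rule idom_embedding_lsub[OF inv(1)])
  have "q = proj_pt (M *v coords p)"
    using f coords_nonzero[of p] \<open>q = f p\<close> by (auto simp: lifted_by_def dest: spec[of _ "coords p"])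
  then obtain a where a: "a \<noteq> 0" "coords q = a *s (M *v coords p)"
    using coords_proj_pt[of "M *v coords p"] lifted_by_vec(3)[OF f coords_nonzero] by metis
  \<comment> \<open>Here \<open>N\<close> maps \<open>coords q\<close> to
    \<open>a *s coords p\<close>, so the value is \<open>a ^ e\<close> times the one at
    \<open>p\<close>: denominators remain admissible.\<close>
  have at_q: "peval (lsub N S) (coords q) \<noteq> 0" if "homogeneous e S" "peval S (coords p) \<noteq> 0" for e S
    using that a by (simp add: peval_lsub peval_scale vec.scale lifted_by_vec[OF f])
  have at_p: "peval (lsub M S) (coords p) \<noteq> 0" if "homogeneous e S" "peval S (coords q) \<noteq> 0" for e S
    using that a by (auto simp: peval_lsub peval_scale)
  have ideal: "m.fract_map ` local_ideal E' q \<subseteq> local_ideal E p"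
    if E: "lsub M (curve_eqn E') = const3 b * curve_eqn E" for E' E b
  proof
    fix r assume "r \<in> m.fract_map ` local_ideal E' q"
    then obtain H S e where r: "r = m.fract_map (Fract (H * curve_eqn E') S)"
      and e: "homogeneous e (H * curve_eqn E')" "homogeneous e S" "peval S (coords q) \<noteq> 0"
      by (auto simp: local_ideal_def)
    from e have "S \<noteq> 0" by auto
    \<comment> \<open>The constant \<open>b\<close> is absorbed into the cofactor of the equation of
      \<open>E\<close>.\<close>
    have eq: "lsub M (H * curve_eqn E') = (const3 b * lsub M H) * curve_eqn E"
      by (simp add: lsub_mult E mult_ac)
    show "r \<in> local_ideal E p"
      unfolding local_ideal_def r m.fract_map_Fract[OF \<open>S \<noteq> 0\<close>] eq
      using e at_p[OF e(2,3)] homogeneous_lsub[OF e(1), of M] homogeneous_lsub[OF e(2), of M]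
      unfolding eq by blast
  qed
  show ?thesis
    unfolding intersection_mult_def
  proof (rule quotient_dim_le[where h = n.fract_map and k = m.fract_map])
    fix b
    show "m.fract_map (n.fract_map b) = b"
      by (cases b rule: Fract_cases)
        (simp add: n.fract_map_Fract m.fract_map_Fract n.h_nonzero lsub_inverse[OF inv(1)])
  next
    show "n.fract_map ` local_ring p \<subseteq> local_ring q"
    proof
      fix r assume "r \<in> n.fract_map ` local_ring p"
      then obtain A S e where r: "r = n.fract_map (Fract A S)"
        and e: "homogeneous e A" "homogeneous e S" "peval S (coords p) \<noteq> 0"
        by (auto simp: local_ring_def)
      then have "S \<noteq> 0" by auto
      then show "r \<in> local_ring q"
        using e at_q[OF e(2,3)] unfolding r local_ring_def
        by (auto simp: n.fract_map_Fract intro: homogeneous_lsub)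
    qed
  next
    show "m.fract_map ` {a + b |a b. a \<in> local_ideal C' q \<and> b \<in> local_ideal D' q}
        \<subseteq> {a + b |a b. a \<in> local_ideal C p \<and> b \<in> local_ideal D p}"
      using ideal[OF C] ideal[OF D] by (force simp: m.fract_map_add)
  next
    show "m.fract_map (sum f A) = (\<Sum>a\<in>A. m.fract_map (f a))" for f :: "poly3 fract \<Rightarrow> _" and A
      by (rule m.fract_map_sum)
  next
    \<comment> \<open>Substitution fixes constants, so the map is complex-linear.\<close>
    show "m.fract_map (Fract (const3 c) 1 * b) = Fract (const3 c) 1 * m.fract_map b" for c b
      by (simp add: m.fract_map_mult m.fract_map_Fract)
  qed
qed

section \<open>Osculating curves\<close>

theorem theorem4p1:
  fixes C L \<Gamma>P \<Gamma>Q :: plane_curve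
    and \<phi> :: "proj_plane \<Rightarrow> proj_plane"
    and P Q :: proj_plane
    and n :: nat
  assumes "plane_automorphism \<phi>"
    and "invariant_curve \<phi> C"
    and "curve_degree L = 1"
    and "\<forall>x\<in>curve_points L. \<phi> x = x"
    and "smooth_point C P"
    and "smooth_point C Q"
    and "\<exists>k::int. Q = int_iterate \<phi> k P"
    and "is_osculating_curve n C P \<Gamma>P"
    and "is_osculating_curve n C Q \<Gamma>Q"
  shows "curve_points \<Gamma>P \<inter> curve_points L = curve_points \<Gamma>Q \<inter> curve_points L"
proof -
  from assms(1) have "bij \<phi>" by (simp add: plane_automorphism_def)
  obtain k where Q: "Q = int_iterate \<phi> k P" using assms(7) by blast
  define \<psi> where "\<psi> = int_iterate \<phi> k"
  have "linear_symmetry (curve_eqn C) \<psi>"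
    unfolding \<psi>_def using assms(1,2) \<open>bij \<phi>\<close>
    by (intro linear_symmetry_int_iterate linear_symmetry_of_invariant_curve)
  then obtain M N c where \<psi>: "lifted_by \<psi> M N" and C: "lsub M (curve_eqn C) = const3 c * curve_eqn C"
    unfolding linear_symmetry_def by blast
  then have inv: "N ** M = mat 1" "M ** N = mat 1" by (auto simp: lifted_by_def)
  let ?G = "curve_eqn \<Gamma>P"
  \<comment> \<open>Pulling the equation back along the inverse matrix pushes the curve forward:
    \<open>lsub N ?G\<close> is an equation of the image of \<open>\<Gamma>P\<close> under
    \<open>\<psi>\<close>.\<close>
  have "lsub N ?G \<noteq> 0" using lsub_inverse[OF inv(1), of ?G] curve_eqn_nonzero[of \<Gamma>P] by auto
  moreover have hom: "homogeneous (curve_degree \<Gamma>P) (lsub N ?G)"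
    by (simp add: homogeneous_lsub homogeneous_curve_eqn_iff)
  ultimately obtain e where e: "e \<noteq> 0" "curve_eqn (curve_of (lsub N ?G)) = const3 e * lsub N ?G"
    using curve_eqn_curve_of curve_degree_pos by metis
  let ?\<Gamma> = "curve_of (lsub N ?G)"
  have "curve_degree ?\<Gamma> = curve_degree \<Gamma>P"
    using homogeneous_const3_mult[OF hom, of e] unfolding e(2)[symmetric] homogeneous_curve_eqn_iff by simp
  moreover have "lsub M (curve_eqn ?\<Gamma>) = const3 e * ?G"
    by (simp add: e lsub_mult lsub_inverse[OF inv(1)])
  then have "intersection_mult C \<Gamma>P P \<le> intersection_mult C ?\<Gamma> Q"
    using intersection_mult_le[OF \<psi> _ C] Q unfolding \<psi>_def by blast
  ultimately have "osculates n C Q ?\<Gamma>"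
    using assms(8) unfolding is_osculating_curve_def osculates_def by auto
  then have \<Gamma>Q: "?\<Gamma> = \<Gamma>Q" using assms(9) by (simp add: is_osculating_curve_def)
  have "x \<in> curve_points \<Gamma>Q \<longleftrightarrow> x \<in> curve_points \<Gamma>P" if "x \<in> curve_points L" for x
  proof -
    have "\<psi> x = x" unfolding \<psi>_def using assms(4) that \<open>bij \<phi>\<close> by (simp add: int_iterate_fixed)
    then have "proj_pt (M *v coords x) = proj_pt (coords x)"
      using \<psi> coords_nonzero[of x] by (auto simp: lifted_by_def dest: spec[of _ "coords x"])
    then obtain a where a: "a \<noteq> 0" "coords x = a *s (M *v coords x)"
      using proj_pt_eq_iff[OF lifted_by_vec(3)[OF \<psi> coords_nonzero] coords_nonzero] by blast
    \<comment> \<open>A fixed point is an eigenvector of \<open>M\<close>, hence of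
      \<open>N\<close>. Its nonzero eigenvalue \<open>a\<close> only rescales the value of the form,
      so vanishing at \<open>x\<close> is the same for both curves.\<close>
    have "N *v coords x = a *s coords x"
      by (subst a(2)) (simp add: vec.scale lifted_by_vec[OF \<psi>])
    then have "peval (lsub N ?G) (coords x) = a ^ curve_degree \<Gamma>P * peval ?G (coords x)"
      by (simp add: peval_lsub peval_scale homogeneous_curve_eqn_iff)
    then show ?thesis
      using a(1) e by (simp add: curve_points_def peval_const_mult flip: \<Gamma>Q)
  qed
  then show ?thesis by auto
qed

end
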